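(* Let $\mathcal F=(F,<,+,\cdot,0,1,\ldots)$ be a d-minimal expansion of an ordered field which is not locally o-minimal. Then the family $\mathfrak D$ of all $(0+)$-sets is not empty and has the following properties: (a) each $D\in\mathfrak D$ is bounded in $F$ and $\operatorname{cl}_F(D)=D\cup\{0\}$; (b) for each $D\in\mathfrak D$ and definable sets $D_1,D_2$ with $D=D_1\cup D_2$, either $D_1$ or $D_2$ contains an element of $\mathfrak D$; (c) for each $D\in\mathfrak D$ and each definable map $\gamma:D\to F^n$, there exists $D'\in\mathfrak D$ such that $D'\subseteq D$ and $\gamma|_{D'}$ is continuous; furthermore, when $\operatorname{Lim}(\gamma)\neq\emptyset$, one can take $D'$ so that $\operatorname{Lim}(\gamma|_{D'})$ is a singleton.
   Context: Let $\mathcal F=(F,<,\ldots)$ be an expansion of a dense linear order without endpoints. "Definable" means definable in $\mathcal F$ with parameters; a definable map is a map between definable sets whose graph is definable. $F$ carries the order topology, $F^n$ the product topology, and subsets of $F^n$ the relative topology. $\mathcal F$ is definably complete if every definable subset of $F$ has both a supremum and an infimum in $F\cup\{\pm\infty\}$. $\mathcal F$ is d-minimal if it is definably complete and every definable subset of $F$ is the union of an open set and finitely many discrete sets, where the number of discrete sets does not depend on the parameters of definition (i.e. for every definable $A\subseteq F^{m+1}$ there is $N\in\mathbb N$ such that for every $x\in F^m$ the fiber $\{y\in F\mid (x,y)\in A\}$ is the union of an open set and at most $N$ discrete sets). $\mathcal F$ is locally o-minimal if for every definable $X\subseteq F$ and every $a\in F$ there is an open interval $I\ni a$ such that $X\cap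 I$ is a finite union of points and open intervals. A $(0+)$-set is a definable subset $D$ of $F$ which is bounded and discrete, is contained in $\{r\in F\mid r>0\}$, and satisfies $\operatorname{cl}_F(D)=D\cup\{0\}$. For a definable set $D\subseteq(0,\infty)$ whose closure contains $0$ and a definable map $f:D\to F^n$, the limit set $\operatorname{Lim}(f)$ is the set of $p\in F^n$ such that $f^{-1}(B)\cap I\ne\emptyset$ for every open box $B\subseteq F^n$ containing $p$ and every open interval $I$ containing $0$. *)

theory Defs
  imports "HOL-Analysis.Analysis" "HOL-Library.Extended" "HOL-Library.Lub_Glb"
begin

text \<open>
  The universe \<open>F\<close> of a structure is a whole type of class \<open>linorder_topology\<close>, so its topology is
  the order topology.  The symbol \<open><\<close> is built into the formulas, so every structure is an
  expansion of the order; ordered fields are automatically dense and without endpoints.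
  Symbols carry no arity: a symbol applied to lists of different lengths stands for several
  symbols of the respective arities.
\<close>

datatype 'f trm = Var nat | App 'f "'f trm list"

datatype ('f, 'r) fml =
    Eq "'f trm" "'f trm"
  | Less "'f trm" "'f trm"
  | Rel 'r "'f trm list"
  | Neg "('f, 'r) fml"
  | Conj "('f, 'r) fml" "('f, 'r) fml"
  | Exi nat "('f, 'r) fml"

record ('a, 'f, 'r) struct =
  fun_interp :: "'f \<Rightarrow> 'a list \<Rightarrow> 'a"
  rel_interp :: "'r \<Rightarrow> 'a list \<Rightarrow> bool"

primrec trm_val :: "('a, 'f, 'r) struct \<Rightarrow> (nat \<Rightarrow> 'a) \<Rightarrow> 'f trm \<Rightarrow> 'a" where
  "trm_val M e (Var i) = e i"
| "trm_val M e (App f ts) = fun_interp M f (map (trm_val M e) ts)"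

primrec sat :: "('a::linorder, 'f, 'r) struct \<Rightarrow> (nat \<Rightarrow> 'a) \<Rightarrow> ('f, 'r) fml \<Rightarrow> bool" where
  "sat M e (Eq s t) \<longleftrightarrow> trm_val M e s = trm_val M e t"
| "sat M e (Less s t) \<longleftrightarrow> trm_val M e s < trm_val M e t"
| "sat M e (Rel r ts) \<longleftrightarrow> rel_interp M r (map (trm_val M e) ts)"
| "sat M e (Neg p) \<longleftrightarrow> \<not> sat M e p"
| "sat M e (Conj p q) \<longleftrightarrow> sat M e p \<and> sat M e q"
| "sat M e (Exi i p) \<longleftrightarrow> (\<exists>a. sat M (e(i := a)) p)"

definition expands_ordered_field :: "('a::linordered_field, 'f, 'r) struct \<Rightarrow> bool" where
  "expands_ordered_field M \<longleftrightarrow> (\<exists>add mul zero one.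
     (\<forall>x y. fun_interp M add [x, y] = x + y) \<and>
     (\<forall>x y. fun_interp M mul [x, y] = x * y) \<and>
     fun_interp M zero [] = 0 \<and>
     fun_interp M one [] = 1)"

text \<open>\<open>F\<^sup>n\<close> consists of the functions on \<open>{..<n}\<close>, extended by \<open>undefined\<close> as required by
  \<^const>\<open>product_topology\<close>.\<close>

definition tuples :: "nat \<Rightarrow> (nat \<Rightarrow> 'a) set" where
  "tuples n = {..<n} \<rightarrow>\<^sub>E UNIV"

definition tuples_topology :: "nat \<Rightarrow> (nat \<Rightarrow> 'a::topological_space) topology" where
  "tuples_topology n = product_topology (\<lambda>_. euclidean) {..<n}"

definition singleton_tuple :: "'a \<Rightarrow> (nat \<Rightarrow> 'a)" where
  "singleton_tuple a = (\<lambda>i\<in>{..<1}. a)"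

definition append_tuples :: "nat \<Rightarrow> nat \<Rightarrow> (nat \<Rightarrow> 'a) \<Rightarrow> (nat \<Rightarrow> 'a) \<Rightarrow> (nat \<Rightarrow> 'a)" where
  "append_tuples m n x y = (\<lambda>i\<in>{..<m + n}. if i < m then x i else y (i - m))"

text \<open>The variables below \<open>n\<close> stand for the coordinates; all other free variables are
  assigned parameters by \<open>e\<close>.\<close>

definition definable :: "('a::linorder, 'f, 'r) struct \<Rightarrow> nat \<Rightarrow> (nat \<Rightarrow> 'a) set \<Rightarrow> bool" where
  "definable M n X \<longleftrightarrow>
     (\<exists>p e. X = {x \<in> tuples n. sat M (\<lambda>i. if i < n then x i else e i) p})"

text \<open>Subsets of \<open>F\<close> are kept as sets of type \<^typ>\<open>'a set\<close> rather than as sets of 1-tuples.\<close>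

definition definable1 :: "('a::linorder, 'f, 'r) struct \<Rightarrow> 'a set \<Rightarrow> bool" where
  "definable1 M X \<longleftrightarrow> definable M 1 (singleton_tuple ` X)"

definition definable_map ::
  "('a::linorder, 'f, 'r) struct \<Rightarrow> 'a set \<Rightarrow> nat \<Rightarrow> ('a \<Rightarrow> (nat \<Rightarrow> 'a)) \<Rightarrow> bool" where
  "definable_map M D n f \<longleftrightarrow> definable1 M D \<and> f ` D \<subseteq> tuples n \<and>
     definable M (1 + n) ((\<lambda>t. append_tuples 1 n (singleton_tuple t) (f t)) ` D)"

definition open_interval :: "'a::linorder set \<Rightarrow> bool" where
  "open_interval I \<longleftrightarrow> (\<exists>a b :: 'a extended. a < b \<and> I = {x. a < Fin x \<and> Fin x < b})"

definition open_box :: "nat \<Rightarrow> (nat \<Rightarrow> 'a::linorder) set \<Rightarrow> bool" where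
  "open_box n B \<longleftrightarrow> (\<exists>I. (\<forall>i<n. open_interval (I i)) \<and> B = (\<Pi>\<^sub>E i\<in>{..<n}. I i))"

definition definably_complete :: "('a::linorder, 'f, 'r) struct \<Rightarrow> bool" where
  "definably_complete M \<longleftrightarrow> (\<forall>X. definable1 M X \<longrightarrow>
     (\<exists>s :: 'a extended. isLub UNIV (Fin ` X) s) \<and> (\<exists>i :: 'a extended. isGlb UNIV (Fin ` X) i))"

definition d_minimal :: "('a::linorder_topology, 'f, 'r) struct \<Rightarrow> bool" where
  "d_minimal M \<longleftrightarrow> definably_complete M \<and>
     (\<forall>m A. definable M (m + 1) A \<longrightarrow>
       (\<exists>N. \<forall>x\<in>tuples m. \<exists>U \<S>. open U \<and> finite \<S> \<and> card \<S> \<le> N \<and> (\<forall>S\<in>\<S>. discrete S) \<and>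
          {y. append_tuples m 1 x (singleton_tuple y) \<in> A} = U \<union> \<Union>\<S>))"

definition locally_o_minimal :: "('a::linorder, 'f, 'r) struct \<Rightarrow> bool" where
  "locally_o_minimal M \<longleftrightarrow> (\<forall>X a. definable1 M X \<longrightarrow>
     (\<exists>I. open_interval I \<and> a \<in> I \<and>
       (\<exists>\<C>. finite \<C> \<and> (\<forall>C\<in>\<C>. is_singleton C \<or> open_interval C) \<and> X \<inter> I = \<Union>\<C>)))"

definition order_bounded :: "'a::linorder set \<Rightarrow> bool" where
  "order_bounded X \<longleftrightarrow> bdd_below X \<and> bdd_above X"

definition zero_plus_sets ::
  "('a::{linordered_field, linorder_topology}, 'f, 'r) struct \<Rightarrow> 'a set set" where
  "zero_plus_sets M = {D. definable1 M D \<and> order_bounded D \<and> discrete D \<and> D \<subseteq> {0<..} \<and>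
     closure D = D \<union> {0}}"

text \<open>Only the values of \<open>f\<close> on \<open>D\<close> matter, so \<open>limit_set D' n f\<close> with \<open>D' \<subseteq> D\<close> is the limit set
  of the restriction of \<open>f\<close> to \<open>D'\<close>.\<close>

definition limit_set ::
  "'a::linordered_field set \<Rightarrow> nat \<Rightarrow> ('a \<Rightarrow> (nat \<Rightarrow> 'a)) \<Rightarrow> (nat \<Rightarrow> 'a) set" where
  "limit_set D n f = {p \<in> tuples n. \<forall>B I. open_box n B \<and> p \<in> B \<and> open_interval I \<and> 0 \<in> I \<longrightarrow>
     {t \<in> D. f t \<in> B} \<inter> I \<noteq> {}}"

end

theory Submission
  imports Defs
begin

text \<open>
  In a \<open>d\<close>-minimal structure the frontier of a definable subset of \<open>F\<close> is a finite union of discrete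
  sets.  If the structure is not locally \<open>o\<close>-minimal, some frontier has a limit point, and by
  induction on the number of discrete sets a closed interval can be found in which it has exactly
  one; translated to \<open>0\<close> and possibly reflected, the frontier yields a \<open>(0+)\<close>-set there.  A definable
  subset of a \<open>(0+)\<close>-set is again one as soon as \<open>0\<close> is a limit point of it.  This gives (b), and it
  reduces (c) to a definable selection of points along which \<open>\<gamma>\<close> converges to a given
  \<open>p \<in> Lim(\<gamma>)\<close>, continuity on a discrete set being automatic.
\<close>

subsection \<open>Definable predicates\<close>

primrec rename_trm :: "(nat \<Rightarrow> nat) \<Rightarrow> 'f trm \<Rightarrow> 'f trm" where
  "rename_trm r (Var i) = Var (r i)"
| "rename_trm r (App f ts) = App f (map (rename_trm r) ts)"

primrec rename_fml :: "(nat \<Rightarrow> nat) \<Rightarrow> ('f, 'r) fml \<Rightarrow> ('f, 'r) fml" where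
  "rename_fml r (Eq s t) = Eq (rename_trm r s) (rename_trm r t)"
| "rename_fml r (Less s t) = Less (rename_trm r s) (rename_trm r t)"
| "rename_fml r (Rel R ts) = Rel R (map (rename_trm r) ts)"
| "rename_fml r (Neg p) = Neg (rename_fml r p)"
| "rename_fml r (Conj p q) = Conj (rename_fml r p) (rename_fml r q)"
| "rename_fml r (Exi i p) = Exi (r i) (rename_fml r p)"

lemma trm_val_rename: "trm_val M e (rename_trm r t) = trm_val M (e \<circ> r) t"
  by (induction t) (auto simp: comp_def intro!: arg_cong[where f = "fun_interp M _"])

text \<open>Bound variables are renamed as well. Injectivity of \<open>r\<close> prevents capture:
  an update of \<open>e\<close> at \<open>r i\<close> is then seen by \<open>e \<circ> r\<close> at
  \<open>i\<close> alone.\<close>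

lemma sat_rename:
  assumes "inj r"
  shows "sat M e (rename_fml r p) \<longleftrightarrow> sat M (e \<circ> r) p"
proof (induction p arbitrary: e)
  case (Exi i p)
  have "e(r i := a) \<circ> r = (e \<circ> r)(i := a)" for a
    using assms by (auto simp: fun_eq_iff dest: injD)
  then show ?case by (simp only: rename_fml.simps sat.simps Exi.IH)
qed (auto simp: trm_val_rename comp_def)

definition env :: "nat \<Rightarrow> (nat \<Rightarrow> 'a) \<Rightarrow> (nat \<Rightarrow> 'a) \<Rightarrow> nat \<Rightarrow> 'a" where
  "env n x e = (\<lambda>i. if i < n then x i else e i)"

text \<open>The predicate lives on all functions rather than on \<open>tuples n\<close>. Passing
  through \<open>env\<close> makes it depend on the first \<open>n\<close> places only, so
  extensionality does not matter until a set of tuples is formed.\<close>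

definition definable_pred ::
  "('a::linorder, 'f, 'r) struct \<Rightarrow> nat \<Rightarrow> ((nat \<Rightarrow> 'a) \<Rightarrow> bool) \<Rightarrow> bool" where
  "definable_pred M n P \<longleftrightarrow> (\<exists>p e. \<forall>x. P x \<longleftrightarrow> sat M (env n x e) p)"

definition definable_term ::
  "('a::linorder, 'f, 'r) struct \<Rightarrow> nat \<Rightarrow> ((nat \<Rightarrow> 'a) \<Rightarrow> 'a) \<Rightarrow> bool" where
  "definable_term M n f \<longleftrightarrow> (\<exists>t e. \<forall>x. f x = trm_val M (env n x e) t)"

text \<open>Two parameter assignments are interleaved on the even and the odd places after \<open>n\<close>.\<close>

lemma merge_parameters:
  "\<exists>r1 r2 e. inj r1 \<and> inj r2 \<and>
    (\<forall>x. env n x e \<circ> r1 = env n x e1) \<and> (\<forall>x. env n x e \<circ> r2 = env n x e2)"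
proof (intro exI conjI allI)
  let ?r1 = "\<lambda>i. if i < n then i else n + 2 * (i - n)"
  let ?r2 = "\<lambda>i. if i < n then i else n + 2 * (i - n) + 1"
  let ?e = "\<lambda>i. if even (i - n) then e1 (n + (i - n) div 2) else e2 (n + (i - n) div 2)"
  show "inj ?r1" by (rule injI) (simp split: if_splits)
  show "inj ?r2" by (rule injI) (simp split: if_splits)
  show "env n x ?e \<circ> ?r1 = env n x e1" for x by (auto simp: env_def fun_eq_iff)
  show "env n x ?e \<circ> ?r2 = env n x e2" for x by (auto simp: env_def fun_eq_iff)
qed

lemma definable_term_var: "i < n \<Longrightarrow> definable_term M n (\<lambda>x. x i)"
  unfolding definable_term_def by (rule exI[of _ "Var i"]) (simp add: env_def)

lemma definable_term_const: "definable_term M n (\<lambda>x. c)"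
  unfolding definable_term_def
  by (rule exI[of _ "Var n"], rule exI[of _ "\<lambda>_. c"]) (simp add: env_def)

text \<open>The two hypotheses bring their own parameters, while an atomic formula or a compound
  term is evaluated under one assignment; merging supplies it.\<close>

lemma definable_term_pair:
  assumes "definable_term M n f" "definable_term M n g"
  shows "\<exists>s t e. \<forall>x. f x = trm_val M (env n x e) s \<and> g x = trm_val M (env n x e) t"
proof -
  obtain s e1 t e2 where s: "\<And>x. f x = trm_val M (env n x e1) s"
    and t: "\<And>x. g x = trm_val M (env n x e2) t"
    using assms unfolding definable_term_def by metis
  obtain r1 r2 e where "inj r1" "inj r2"
    "\<forall>x. env n x e \<circ> r1 = env n x e1" "\<forall>x. env n x e \<circ> r2 = env n x e2"
    using merge_parameters[of n e1 e2] by blast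
  then show ?thesis
    using s t by (intro exI[of _ "rename_trm r1 s"] exI[of _ "rename_trm r2 t"] exI[of _ e])
      (simp_all add: trm_val_rename)
qed

lemma definable_term_add:
  assumes "expands_ordered_field M" "definable_term M n f" "definable_term M n g"
  shows "definable_term M n (\<lambda>x. f x + g x)"
proof -
  obtain add where add: "\<And>x y. fun_interp M add [x, y] = x + y"
    using assms(1) unfolding expands_ordered_field_def by blast
  obtain s t e where "\<forall>x. f x = trm_val M (env n x e) s \<and> g x = trm_val M (env n x e) t"
    using definable_term_pair[OF assms(2,3)] by blast
  then have "\<forall>x. f x + g x = trm_val M (env n x e) (App add [s, t])"
    by (simp add: add)
  then show ?thesis unfolding definable_term_def by blast
qed

lemma definable_pred_eq:
  assumes "definable_term M n f" "definable_term M n g"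
  shows "definable_pred M n (\<lambda>x. f x = g x)"
proof -
  obtain s t e where "\<forall>x. f x = trm_val M (env n x e) s \<and> g x = trm_val M (env n x e) t"
    using definable_term_pair[OF assms] by blast
  then have "\<forall>x. f x = g x \<longleftrightarrow> sat M (env n x e) (Eq s t)" by simp
  then show ?thesis unfolding definable_pred_def by blast
qed

lemma definable_pred_less:
  assumes "definable_term M n f" "definable_term M n g"
  shows "definable_pred M n (\<lambda>x. f x < g x)"
proof -
  obtain s t e where "\<forall>x. f x = trm_val M (env n x e) s \<and> g x = trm_val M (env n x e) t"
    using definable_term_pair[OF assms] by blast
  then have "\<forall>x. f x < g x \<longleftrightarrow> sat M (env n x e) (Less s t)" by simp
  then show ?thesis unfolding definable_pred_def by blast
qed

lemma definable_pred_not: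
  assumes "definable_pred M n P"
  shows "definable_pred M n (\<lambda>x. \<not> P x)"
proof -
  obtain p e where "\<And>x. P x \<longleftrightarrow> sat M (env n x e) p"
    using assms unfolding definable_pred_def by blast
  then have "\<forall>x. \<not> P x \<longleftrightarrow> sat M (env n x e) (Neg p)" by simp
  then show ?thesis unfolding definable_pred_def by blast
qed

lemma definable_pred_le:
  assumes "definable_term M n f" "definable_term M n g"
  shows "definable_pred M n (\<lambda>x. f x \<le> g x)"
  using definable_pred_not[OF definable_pred_less[OF assms(2,1)]] by (simp add: not_less)

lemma definable_pred_conj:
  assumes "definable_pred M n P" "definable_pred M n Q"
  shows "definable_pred M n (\<lambda>x. P x \<and> Q x)"
proof -
  obtain p e1 q e2 where p: "\<And>x. P x \<longleftrightarrow> sat M (env n x e1) p"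
    and q: "\<And>x. Q x \<longleftrightarrow> sat M (env n x e2) q"
    using assms unfolding definable_pred_def by metis
  obtain r1 r2 e where "inj r1" "inj r2"
    "\<forall>x. env n x e \<circ> r1 = env n x e1" "\<forall>x. env n x e \<circ> r2 = env n x e2"
    using merge_parameters[of n e1 e2] by blast
  then have "\<forall>x. P x \<and> Q x \<longleftrightarrow> sat M (env n x e) (Conj (rename_fml r1 p) (rename_fml r2 q))"
    by (simp add: sat_rename p q)
  then show ?thesis unfolding definable_pred_def by blast
qed

lemma definable_pred_imp:
  assumes "definable_pred M n P" "definable_pred M n Q"
  shows "definable_pred M n (\<lambda>x. P x \<longrightarrow> Q x)"
  using definable_pred_not[OF definable_pred_conj[OF assms(1) definable_pred_not[OF assms(2)]]]
  by simp

lemma definable_pred_True: "definable_pred M n (\<lambda>x. True)"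
  using definable_pred_eq[OF definable_term_const definable_term_const, of M n undefined undefined]
  by simp

lemma definable_pred_all_less:
  fixes m :: nat
  assumes "\<And>i. i < m \<Longrightarrow> definable_pred M n (\<lambda>x. P i x)"
  shows "definable_pred M n (\<lambda>x. \<forall>i<m. P i x)"
  using assms
proof (induction m)
  case 0
  then show ?case by (simp add: definable_pred_True)
next
  case (Suc m)
  have "definable_pred M n (\<lambda>x. P m x \<and> (\<forall>i<m. P i x))"
    by (rule definable_pred_conj) (use Suc in simp_all)
  then show ?case by (simp add: All_less_Suc)
qed

text \<open>The formula for \<open>P\<close> reads place \<open>n\<close> as a coordinate and not as
  a parameter, so that place can be bound without a clash.\<close>

lemma definable_pred_ex_update:
  assumes "definable_pred M (Suc n) P"
  shows "definable_pred M n (\<lambda>x. \<exists>a. P (x(n := a)))"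
proof -
  obtain p e where p: "\<And>x. P x \<longleftrightarrow> sat M (env (Suc n) x e) p"
    using assms unfolding definable_pred_def by blast
  have "env (Suc n) (x(n := a)) e = (env n x e)(n := a)" for x a
    by (auto simp: env_def fun_eq_iff)
  then have "\<forall>x. (\<exists>a. P (x(n := a))) \<longleftrightarrow> sat M (env n x e) (Exi n p)"
    by (simp add: p)
  then show ?thesis unfolding definable_pred_def by blast
qed

text \<open>The second premise says that \<open>Q x\<close> does not look at the place \<open>n\<close> taken by the bound
  variable.\<close>

lemma definable_pred_ex:
  assumes "definable_pred M (Suc n) (\<lambda>x. Q x (x n))" "\<And>x a b. Q (x(n := a)) b = Q x b"
  shows "definable_pred M n (\<lambda>x. \<exists>a. Q x a)"
  using definable_pred_ex_update[OF assms(1)] by (simp only: assms(2) fun_upd_same)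

lemma definable_pred_all:
  assumes "definable_pred M (Suc n) (\<lambda>x. Q x (x n))" "\<And>x a b. Q (x(n := a)) b = Q x b"
  shows "definable_pred M n (\<lambda>x. \<forall>a. Q x a)"
proof -
  have "definable_pred M n (\<lambda>x. \<not> (\<exists>a. \<not> Q x a))"
    by (rule definable_pred_not, rule definable_pred_ex, rule definable_pred_not, rule assms(1))
      (simp only: assms(2))
  then show ?thesis by simp
qed

text \<open>The last \<open>m\<close> coordinates are quantified away one at a time, starting from
  the last. The witness \<open>y\<close> may be any function, because only its first
  \<open>m\<close> values are seen by \<open>P\<close>.\<close>

lemma definable_pred_ex_block:
  assumes "definable_pred M (k + m) P"
  shows "definable_pred M k (\<lambda>x. \<exists>y. P (\<lambda>i. if i < k then x i else y (i - k)))"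
  using assms
proof (induction m arbitrary: P)
  case 0
  then obtain p e where p: "\<And>x. P x \<longleftrightarrow> sat M (env k x e) p"
    unfolding definable_pred_def by auto
  have "env k (\<lambda>i. if i < k then x i else y (i - k)) e = env k x e" for x y
    by (auto simp: env_def fun_eq_iff)
  then have "\<forall>x. (\<exists>y. P (\<lambda>i. if i < k then x i else y (i - k))) \<longleftrightarrow> sat M (env k x e) p"
    by (simp add: p)
  then show ?case unfolding definable_pred_def by blast
next
  case (Suc m)
  \<comment> \<open>Overwriting place \<open>k + m\<close> by \<open>a\<close> amounts to changing
    \<open>y m\<close>, and \<open>y\<close> ranges over all functions anyway.\<close>
  have *: "(\<exists>y a. P ((\<lambda>i. if i < k then x i else y (i - k))(k + m := a))) \<longleftrightarrow>
    (\<exists>y. P (\<lambda>i. if i < k then x i else y (i - k)))" for x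
  proof -
    have eq: "(\<lambda>i. if i < k then x i else y (i - k))(k + m := a) =
      (\<lambda>i. if i < k then x i else (y(m := a)) (i - k))" for y a
      by (auto simp: fun_eq_iff)
    show ?thesis unfolding eq
    proof
      assume "\<exists>y. P (\<lambda>i. if i < k then x i else y (i - k))"
      then obtain y where "P (\<lambda>i. if i < k then x i else y (i - k))" by blast
      then have "P (\<lambda>i. if i < k then x i else (y(m := y m)) (i - k))"
        by (simp only: fun_upd_triv)
      then show "\<exists>y a. P (\<lambda>i. if i < k then x i else (y(m := a)) (i - k))" by blast
    qed blast
  qed
  have "definable_pred M (k + m) (\<lambda>x. \<exists>a. P (x(k + m := a)))"
    using Suc.prems by (intro definable_pred_ex_update) simp
  from Suc.IH[OF this] show ?case unfolding * .
qed

lemma definable_pred_rename: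
  assumes "definable_pred M m P" "inj_on r {..<m}" "\<And>j. j < m \<Longrightarrow> r j < n"
  shows "definable_pred M n (\<lambda>x. P (\<lambda>j. x (r j)))"
proof -
  obtain p e where p: "\<And>x. P x \<longleftrightarrow> sat M (env m x e) p"
    using assms(1) unfolding definable_pred_def by blast
  \<comment> \<open>Parameter places are moved beyond \<open>n\<close>, away from all coordinates,
    which keeps the extended renaming injective; the new assignment shifts them back.\<close>
  let ?r = "\<lambda>j. if j < m then r j else n + j"
  have inj: "inj ?r"
  proof (rule injI)
    fix i j assume "?r i = ?r j"
    then show "i = j"
      using assms(2) assms(3)[of i] assms(3)[of j]
      by (auto simp: inj_on_def split: if_splits)
  qed
  have "env n x (\<lambda>i. e (i - n)) \<circ> ?r = env m (\<lambda>j. x (r j)) e" for x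
    using assms(3) by (auto simp: env_def fun_eq_iff)
  then have "\<forall>x. P (\<lambda>j. x (r j)) \<longleftrightarrow> sat M (env n x (\<lambda>i. e (i - n))) (rename_fml ?r p)"
    by (simp add: sat_rename[OF inj] p)
  then show ?thesis unfolding definable_pred_def by blast
qed

lemma definable_pred_binary:
  assumes "definable_pred M 2 (\<lambda>x. G (x 0) (x 1))" "i < n" "j < n" "i \<noteq> j"
  shows "definable_pred M n (\<lambda>x. G (x i) (x j))"
proof -
  let ?r = "\<lambda>k. if k = (0::nat) then i else j"
  have "definable_pred M n (\<lambda>x. G (x (?r 0)) (x (?r 1)))"
    by (rule definable_pred_rename[where P = "\<lambda>x. G (x 0) (x 1)" and r = ?r, OF assms(1)])
      (use assms(2-) in \<open>auto simp: inj_on_def less_2_cases_iff\<close>)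
  then show ?thesis by simp
qed

text \<open>This links sets of extensional tuples with predicates on arbitrary functions: cutting
  \<open>x\<close> down to the coordinates does not affect satisfaction.\<close>

lemma definable_pred_mem_tuples:
  assumes "definable M m A" "inj_on r {..<m}" "\<And>j. j < m \<Longrightarrow> r j < n"
  shows "definable_pred M n (\<lambda>x. (\<lambda>j\<in>{..<m}. x (r j)) \<in> A)"
proof -
  obtain p e where A: "A = {x \<in> tuples m. sat M (env m x e) p}"
    using assms(1) unfolding definable_def env_def by blast
  have "env m (\<lambda>j\<in>{..<m}. x j) e = env m x e" for x
    by (auto simp: env_def fun_eq_iff)
  then have "\<forall>x. (\<lambda>j\<in>{..<m}. x j) \<in> A \<longleftrightarrow> sat M (env m x e) p"
    by (simp add: A tuples_def)
  then have "definable_pred M m (\<lambda>x. (\<lambda>j\<in>{..<m}. x j) \<in> A)"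
    unfolding definable_pred_def by blast
  from definable_pred_rename[OF this assms(2,3)] show ?thesis .
qed

section \<open>Definable subsets of the line\<close>

lemma singleton_tuple_eq_iff: "singleton_tuple a = singleton_tuple b \<longleftrightarrow> a = b"
  by (auto simp: singleton_tuple_def fun_eq_iff)

lemma singleton_tuple_mem_iff: "singleton_tuple a \<in> singleton_tuple ` X \<longleftrightarrow> a \<in> X"
  by (auto simp: singleton_tuple_eq_iff)

lemma definable_pred_mem:
  fixes M :: "('a::linorder, 'f, 'r) struct"
  assumes "definable1 M X" "i < n"
  shows "definable_pred M n (\<lambda>x. x i \<in> X)"
proof -
  have "(\<lambda>j\<in>{..<1}. x i) = singleton_tuple (x i)" for x :: "nat \<Rightarrow> 'a"
    by (simp add: singleton_tuple_def)
  moreover have "definable_pred M n (\<lambda>x. (\<lambda>j\<in>{..<1}. x i) \<in> singleton_tuple ` X)"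
    using assms by (intro definable_pred_mem_tuples) (simp_all add: definable1_def inj_on_def)
  ultimately show ?thesis by (simp only: singleton_tuple_mem_iff)
qed

lemma definable1I:
  assumes "definable_pred M 1 (\<lambda>x. P (x 0))"
  shows "definable1 M {a. P a}"
proof -
  obtain p e where p: "\<And>x. P (x 0) \<longleftrightarrow> sat M (env 1 x e) p"
    using assms unfolding definable_pred_def by blast
  have "singleton_tuple ` {a. P a} = {x \<in> tuples 1. sat M (env 1 x e) p}"
  proof (intro subset_antisym subsetI)
    fix x assume "x \<in> singleton_tuple ` {a. P a}"
    then obtain a where "P a" "x = singleton_tuple a" by blast
    then show "x \<in> {x \<in> tuples 1. sat M (env 1 x e) p}"
      using p[of x] by (simp add: singleton_tuple_def tuples_def)
  next
    fix x assume x: "x \<in> {x \<in> tuples 1. sat M (env 1 x e) p}"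
    then have "x = singleton_tuple (x 0)"
      by (auto simp: singleton_tuple_def tuples_def fun_eq_iff PiE_def extensional_def)
    moreover have "P (x 0)" using x p[of x] by simp
    ultimately show "x \<in> singleton_tuple ` {a. P a}" by blast
  qed
  then show ?thesis unfolding definable1_def definable_def env_def by blast
qed

text \<open>Used as introduction rules, these read definability off the shape of a description. Sets
  are therefore first rewritten so that only order, equality, addition, membership and quantifiers
  occur, without subtraction or absolute values.\<close>

lemmas definable_pred_intros =
  definable_pred_ex definable_pred_all definable_pred_imp definable_pred_conj definable_pred_not
  definable_pred_eq definable_pred_less definable_pred_le definable_pred_mem
  definable_term_var definable_term_const definable_term_add

subsection \<open>Limit points in ordered fields\<close>

lemma open_interval_abs: "{y::'a::linordered_idom. \<bar>y - x\<bar> < e} = {x - e<..<x + e}"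
  by (auto simp: abs_less_iff)

lemma open_abs_less:
  fixes x :: "'a::{linordered_field, linorder_topology}"
  shows "open {y. \<bar>y - x\<bar> < e}"
  unfolding open_interval_abs by simp

text \<open>A general ordered field carries no real-valued metric here, so symmetric intervals play
  the part of balls. The order topology yields a neighbourhood on each side, and the shorter one
  determines the radius.\<close>

lemma open_contains_abs_less:
  fixes x :: "'a::{linordered_field, linorder_topology}"
  assumes "open S" "x \<in> S"
  shows "\<exists>e>0. \<forall>y. \<bar>y - x\<bar> < e \<longrightarrow> y \<in> S"
proof -
  obtain b where b: "x < b" "{x..<b} \<subseteq> S"
    using open_right[OF assms, of "x + 1"] by auto
  obtain c where c: "c < x" "{c<..x} \<subseteq> S"
    using open_left[OF assms, of "x - 1"] by auto
  have "y \<in> S" if "\<bar>y - x\<bar> < min (b - x) (x - c)" for y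
  proof -
    have "c < y" "y < b" using that by (auto simp: abs_less_iff)
    then show ?thesis using b(2) c(2) by (cases "x \<le> y") auto
  qed
  then show ?thesis using b(1) c(1) by (intro exI[of _ "min (b - x) (x - c)"]) simp
qed

lemma islimpt_abs:
  fixes x :: "'a::{linordered_field, linorder_topology}"
  shows "x islimpt S \<longleftrightarrow> (\<forall>e>0. \<exists>y\<in>S. y \<noteq> x \<and> \<bar>y - x\<bar> < e)"
proof
  assume *: "x islimpt S"
  show "\<forall>e>0. \<exists>y\<in>S. y \<noteq> x \<and> \<bar>y - x\<bar> < e"
  proof (intro allI impI)
    fix e :: 'a assume "e > 0"
    then have "x \<in> {y. \<bar>y - x\<bar> < e}" by simp
    from islimptE[OF * this open_abs_less]
    show "\<exists>y\<in>S. y \<noteq> x \<and> \<bar>y - x\<bar> < e" by blast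
  qed
next
  assume *: "\<forall>e>0. \<exists>y\<in>S. y \<noteq> x \<and> \<bar>y - x\<bar> < e"
  show "x islimpt S"
  proof (rule islimptI)
    fix T assume "x \<in> T" "open T"
    then obtain e where "e > 0" "\<forall>y. \<bar>y - x\<bar> < e \<longrightarrow> y \<in> T"
      using open_contains_abs_less by blast
    then show "\<exists>y\<in>S. y \<in> T \<and> y \<noteq> x" using * by blast
  qed
qed

lemma mem_interior_abs:
  fixes x :: "'a::{linordered_field, linorder_topology}"
  shows "x \<in> interior S \<longleftrightarrow> (\<exists>e>0. \<forall>y. \<bar>y - x\<bar> < e \<longrightarrow> y \<in> S)"
proof
  assume "x \<in> interior S"
  then show "\<exists>e>0. \<forall>y. \<bar>y - x\<bar> < e \<longrightarrow> y \<in> S"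
    using open_contains_abs_less[OF open_interior, of x S] interior_subset[of S] by blast
next
  assume "\<exists>e>0. \<forall>y. \<bar>y - x\<bar> < e \<longrightarrow> y \<in> S"
  then obtain e where "e > 0" "{y. \<bar>y - x\<bar> < e} \<subseteq> S" by blast
  then show "x \<in> interior S"
    by (intro interiorI[OF open_abs_less[of x e]]) simp_all
qed

lemma islimpt_Int_interval:
  fixes x :: "'a::{linordered_field, linorder_topology}"
  assumes "x islimpt S" "d > 0"
  shows "x islimpt S \<inter> {x - d..x + d}"
  unfolding islimpt_abs
proof (intro allI impI)
  fix e :: 'a assume "e > 0"
  then have "min e d > 0" using assms(2) by simp
  then obtain y where y: "y \<in> S" "y \<noteq> x" "\<bar>y - x\<bar> < min e d"
    using assms(1) unfolding islimpt_abs by blast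
  then have "y \<in> {x - d..x + d}" by (auto simp: abs_less_iff)
  then show "\<exists>y\<in>S \<inter> {x - d..x + d}. y \<noteq> x \<and> \<bar>y - x\<bar> < e" using y by auto
qed

lemma isolated_limit_point:
  fixes C :: "'a::{linordered_field, linorder_topology} set"
  assumes "finite \<S>" "\<And>S. S \<in> \<S> \<Longrightarrow> discrete S" "closed C" "C \<subseteq> \<Union>\<S>" "b islimpt C"
  shows "\<exists>u v a. {x. x islimpt C \<inter> {u..v}} = {a}"
  using assms
proof (induction "card \<S>" arbitrary: \<S> C b rule: less_induct)
  case less
  have "b \<in> C" using less.prems(3,5) closed_limpt by blast
  then obtain S where S: "S \<in> \<S>" "b \<in> S" using less.prems(4) by blast
  then have "\<not> b islimpt S"
    using less.prems(2) isolated_in_islimpt_iff discreteD by blast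
  then obtain e where e: "e > 0" "\<And>y. y \<in> S \<Longrightarrow> \<bar>y - b\<bar> < e \<Longrightarrow> y = b"
    unfolding islimpt_abs by blast
  \<comment> \<open>Half of \<open>e\<close> is taken so that the closed interval still lies in the
    open one of radius \<open>e\<close>, where \<open>b\<close> is the only point of
    \<open>S\<close>.\<close>
  define K where "K = {b - e / 2..b + e / 2}"
  have K: "y = b" if "y \<in> S" "y \<in> K" for y
  proof (rule e(2)[OF that(1)])
    show "\<bar>y - b\<bar> < e" using that(2) e(1) unfolding K_def abs_less_iff by (auto simp: field_simps)
  qed
  have limb: "b islimpt C \<inter> K"
    unfolding K_def by (rule islimpt_Int_interval) (use less.prems(5) e(1) in auto)
  show ?case
  proof (cases "\<exists>c. c \<noteq> b \<and> c islimpt C \<inter> K")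
    case False
    then have "{x. x islimpt C \<inter> K} = {b}" using limb by blast
    then show ?thesis unfolding K_def by blast
  next
    case True
    then obtain c where c: "c \<noteq> b" "c islimpt C \<inter> K" by blast
    \<comment> \<open>With half the distance as radius, the interval around \<open>c\<close> misses
      \<open>b\<close>, the only point of \<open>S\<close> in \<open>K\<close>.\<close>
    define d where "d = \<bar>c - b\<bar> / 2"
    have d: "d > 0" using c(1) by (simp add: d_def)
    define C' where "C' = C \<inter> K \<inter> {c - d..c + d}"
    have "b \<notin> {c - d..c + d}"
      using c(1) unfolding d_def by (auto simp: abs_if field_simps split: if_splits)
    then have sub: "C' \<subseteq> \<Union>(\<S> - {S})"
      using K less.prems(4) unfolding C'_def by blast
    have "closed C'" unfolding C'_def K_def using less.prems(3) by (intro closed_Int) auto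
    moreover have "c islimpt C'" unfolding C'_def using c(2) d by (rule islimpt_Int_interval)
    moreover have "card (\<S> - {S}) < card \<S>"
      using S(1) less.prems(1) by (rule card_Diff1_less[rotated])
    ultimately obtain u v a where "{x. x islimpt C' \<inter> {u..v}} = {a}"
      using less.hyps[of "\<S> - {S}" C' c] less.prems(1,2) sub by blast
    \<comment> \<open>Three nested restrictions to closed intervals are again the restriction to one
      closed interval, as the conclusion requires for \<open>C\<close>.\<close>
    moreover have "C' \<inter> {u..v} =
      C \<inter> {max (max (b - e / 2) (c - d)) u..min (min (b + e / 2) (c + d)) v}"
      unfolding C'_def K_def by auto
    ultimately show ?thesis by metis
  qed
qed

lemma definable_sup:
  fixes M :: "('a::linordered_field, 'f, 'r) struct"
  assumes "definably_complete M" "definable1 M X" "X \<noteq> {}" "\<And>x. x \<in> X \<Longrightarrow> x \<le> b"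
  obtains s where "\<And>x. x \<in> X \<Longrightarrow> x \<le> s" "\<And>e. e > 0 \<Longrightarrow> \<exists>x\<in>X. s - e < x"
proof -
  obtain s :: "'a extended" where s: "isLub UNIV (Fin ` X) s"
    using assms(1,2) unfolding definably_complete_def by blast
  have ub: "Fin x \<le> s" if "x \<in> X" for x
    using s that unfolding isLub_def leastP_def isUb_def setle_def by blast
  have least: "s \<le> Fin y" if "\<And>x. x \<in> X \<Longrightarrow> x \<le> y" for y
    using s that unfolding isLub_def leastP_def isUb_def setle_def setge_def by auto
  \<comment> \<open>Nonemptiness excludes the value \<open>Minf\<close> and the bound
    \<open>b\<close> excludes \<open>Pinf\<close>, so the supremum is an element of the
    field.\<close>
  have "s \<noteq> Minf" using ub assms(3) by auto
  moreover have "s \<noteq> Pinf" using least[OF assms(4)] by auto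
  ultimately obtain r where r: "s = Fin r" by (cases s) auto
  show thesis
  proof
    show "x \<le> r" if "x \<in> X" for x using ub[OF that] r by simp
    show "\<exists>x\<in>X. r - e < x" if "e > 0" for e
    proof (rule ccontr)
      assume "\<not> (\<exists>x\<in>X. r - e < x)"
      then have "r \<le> r - e" using least[of "r - e"] r by (simp add: not_less)
      then show False using that by simp
    qed
  qed
qed

section \<open>(0+)-sets in terms of limit points\<close>

lemma zero_plus_setsI:
  fixes M :: "('a::{linordered_field, linorder_topology}, 'f, 'r) struct"
  assumes "definable1 M D" "D \<subseteq> {0<..}" "\<And>t. t \<in> D \<Longrightarrow> t \<le> c" "{x. x islimpt D} = {0}"
  shows "D \<in> zero_plus_sets M"
proof -
  have "bdd_below D" using assms(2) by (intro bdd_belowI[of _ 0]) auto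
  moreover have "bdd_above D" using assms(3) by (rule bdd_aboveI)
  \<comment> \<open>The only limit point is \<open>0\<close>, which lies outside \<open>D\<close>,
    so each point of \<open>D\<close> is isolated.\<close>
  moreover have "discrete D"
  proof (rule discreteI)
    fix x assume "x \<in> D"
    moreover from this have "x \<notin> {x. x islimpt D}" unfolding assms(4) using assms(2) by auto
    ultimately show "x isolated_in D" by (simp add: isolated_in_islimpt_iff)
  qed
  moreover have "closure D = D \<union> {0}" unfolding closure_def assms(4) ..
  ultimately show ?thesis
    using assms(1,2) by (simp add: zero_plus_sets_def order_bounded_def)
qed

text \<open>Discreteness keeps all limit points outside \<open>D\<close>, so they are exactly what
  the closure adds.\<close>

lemma zero_plus_sets_limit_points:
  assumes "D \<in> zero_plus_sets M"
  shows "{x. x islimpt D} = {0}"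
proof -
  have D: "discrete D" "D \<subseteq> {0<..}" "closure D = D \<union> {0}"
    using assms unfolding zero_plus_sets_def by auto
  have "D \<inter> {x. x islimpt D} = {}"
    using discreteD[OF D(1)] by (auto simp: isolated_in_islimpt_iff)
  moreover have "0 \<notin> D" using D(2) by auto
  moreover have "D \<union> {x. x islimpt D} = D \<union> {0}" using D(3) unfolding closure_def .
  ultimately show ?thesis by blast
qed

lemma zero_islimpt_iff:
  fixes D :: "'a::{linordered_field, linorder_topology} set"
  assumes "D \<subseteq> {0<..}"
  shows "0 islimpt D \<longleftrightarrow> (\<forall>e>0. \<exists>t\<in>D. t < e)"
proof -
  have "y \<noteq> 0 \<and> \<bar>y - 0\<bar> = y" if "y \<in> D" for y
    using subsetD[OF assms that] by simp
  then show ?thesis unfolding islimpt_abs by (simp cong: bex_cong)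
qed

text \<open>A subset can only lose limit points, so the sole question is whether \<open>0\<close>
  survives.\<close>

lemma zero_plus_sets_subset:
  assumes "D \<in> zero_plus_sets M" "D' \<subseteq> D" "definable1 M D'" "0 islimpt D'"
  shows "D' \<in> zero_plus_sets M"
proof -
  obtain c where c: "\<And>t. t \<in> D \<Longrightarrow> t \<le> c"
    using assms(1) by (auto simp: zero_plus_sets_def order_bounded_def bdd_above_def)
  show ?thesis
  proof (rule zero_plus_setsI[OF assms(3)])
    show "D' \<subseteq> {0<..}" using assms(1,2) by (auto simp: zero_plus_sets_def)
    show "t \<le> c" if "t \<in> D'" for t using that c assms(2) by blast
    show "{x. x islimpt D'} = {0}"
    proof -
      have "{x. x islimpt D'} \<subseteq> {0}"
        using islimpt_subset[OF _ assms(2)] unfolding zero_plus_sets_limit_points[OF assms(1), symmetric]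
        by auto
      then show ?thesis using assms(4) by auto
    qed
  qed
qed

text \<open>All singletons are open in the subspace, so it carries the discrete topology.\<close>

lemma continuous_map_discrete:
  assumes "discrete D" "f ` D \<subseteq> topspace Y"
  shows "continuous_map (top_of_set D) Y f"
proof -
  have "openin (top_of_set D) {x}" if "x \<in> D" for x
    using discreteD[OF assms(1) that] unfolding isolated_in_def openin_open by blast
  then have "top_of_set D = discrete_topology D"
    using discrete_topology_unique[of D "top_of_set D"] by simp
  then show ?thesis using assms(2) by auto
qed

subsection \<open>Existence of \<open>(0+)\<close>-sets\<close>

lemma definable_interior:
  fixes M :: "('a::{linordered_field, linorder_topology}, 'f, 'r) struct"
  assumes "expands_ordered_field M" "definable1 M X"
  shows "definable1 M (interior X)"
proof -
  have "\<bar>y - x\<bar> < e \<longleftrightarrow> y < x + e \<and> x < y + e" for x y e :: 'a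
    by (auto simp: abs_less_iff algebra_simps)
  then have "interior X = {x. \<exists>e. 0 < e \<and> (\<forall>y. y < x + e \<and> x < y + e \<longrightarrow> y \<in> X)}"
    by (simp add: set_eq_iff mem_interior_abs)
  also have "definable1 M \<dots>"
    using assms by (intro definable1I definable_pred_intros) simp_all
  finally show ?thesis .
qed

lemma definable_Compl:
  assumes "definable1 M X"
  shows "definable1 M (- X)"
  unfolding Compl_eq
  using assms by (intro definable1I definable_pred_intros) simp_all

lemma definable_Int:
  assumes "definable1 M X" "definable1 M Y"
  shows "definable1 M (X \<inter> Y)"
  unfolding Int_def
  using assms by (intro definable1I definable_pred_intros) simp_all

lemma definable_atLeastAtMost: "definable1 M {u..v}"
proof -
  have "{u..v} = {x. u \<le> x \<and> x \<le> v}" by auto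
  also have "definable1 M \<dots>"
    by (intro definable1I definable_pred_intros) simp_all
  finally show ?thesis .
qed

lemma definable_frontier:
  fixes M :: "('a::{linordered_field, linorder_topology}, 'f, 'r) struct"
  assumes "expands_ordered_field M" "definable1 M X"
  shows "definable1 M (frontier X)"
proof -
  have "frontier X = - interior X \<inter> - interior (- X)"
    unfolding frontier_interiors by (simp add: Diff_eq)
  then show ?thesis
    using assms by (simp add: definable_Int definable_Compl definable_interior)
qed

text \<open>This is the uniform condition for \<open>m = 0\<close>: there is a single empty tuple,
  constantly \<open>undefined\<close>, and the fiber over it is \<open>X\<close>.\<close>

lemma d_minimal_definable1:
  fixes M :: "('a::linorder_topology, 'f, 'r) struct"
  assumes "d_minimal M" "definable1 M X"
  shows "\<exists>U \<S>. open U \<and> finite \<S> \<and> (\<forall>S\<in>\<S>. discrete S) \<and> X = U \<union> \<Union>\<S>"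
proof -
  have def: "definable M (0 + 1) (singleton_tuple ` X)"
    using assms(2) by (simp add: definable1_def)
  have append: "append_tuples 0 1 x (singleton_tuple y) = singleton_tuple y" for x and y :: 'a
    by (auto simp: append_tuples_def singleton_tuple_def fun_eq_iff)
  have "(\<lambda>_. undefined :: 'a) \<in> tuples 0" by (simp add: tuples_def)
  with assms(1)[unfolded d_minimal_def, THEN conjunct2, rule_format, OF def]
  show ?thesis
    unfolding append singleton_tuple_mem_iff Collect_mem_eq by blast
qed

text \<open>The open part of a decomposition of \<open>X - interior X\<close> is an open subset of
  \<open>X\<close>, hence inside \<open>interior X\<close>, hence empty. Only the discrete sets
  remain.\<close>

lemma diff_interior_finite_discrete:
  fixes M :: "('a::{linordered_field, linorder_topology}, 'f, 'r) struct"
  assumes "expands_ordered_field M" "d_minimal M" "definable1 M X"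
  shows "\<exists>\<S>. finite \<S> \<and> (\<forall>S\<in>\<S>. discrete S) \<and> X - interior X = \<Union>\<S>"
proof -
  have "definable1 M (X - interior X)"
    unfolding Diff_eq
    by (rule definable_Int[OF assms(3) definable_Compl[OF definable_interior[OF assms(1,3)]]])
  from d_minimal_definable1[OF assms(2) this] obtain U \<S> where U: "open U" "finite \<S>"
    "\<forall>S\<in>\<S>. discrete S" "X - interior X = U \<union> \<Union>\<S>"
    by (elim exE conjE)
  have "U \<subseteq> X - interior X" unfolding U(4) by (rule Un_upper1)
  moreover from this have "U \<subseteq> interior X" using U(1)
    by (simp add: interior_maximal subset_trans[OF _ Diff_subset])
  ultimately have "U = {}" by blast
  then show ?thesis using U(2-4) by auto
qed

text \<open>A frontier point lies in \<open>X\<close> or in \<open>- X\<close> and in the interior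
  of neither, so the preceding result applied to both sets covers it.\<close>

lemma frontier_finite_discrete:
  fixes M :: "('a::{linordered_field, linorder_topology}, 'f, 'r) struct"
  assumes "expands_ordered_field M" "d_minimal M" "definable1 M X"
  shows "\<exists>\<S>. finite \<S> \<and> (\<forall>S\<in>\<S>. discrete S) \<and> frontier X \<subseteq> \<Union>\<S>"
proof -
  obtain \<S> where S: "finite \<S>" "\<forall>S\<in>\<S>. discrete S" "X - interior X = \<Union>\<S>"
    using diff_interior_finite_discrete[OF assms] by (elim exE conjE)
  obtain \<T> where T: "finite \<T>" "\<forall>S\<in>\<T>. discrete S" "- X - interior (- X) = \<Union>\<T>"
    using diff_interior_finite_discrete[OF assms(1,2) definable_Compl[OF assms(3)]]
    by (elim exE conjE)
  have "frontier X \<subseteq> (X - interior X) \<union> (- X - interior (- X))"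
    unfolding frontier_interiors by auto
  then have "frontier X \<subseteq> \<Union>(\<S> \<union> \<T>)" unfolding S(3) T(3) by simp
  then show ?thesis using S(1,2) T(1,2) by (intro exI[of _ "\<S> \<union> \<T>"]) auto
qed

text \<open>The usual connectedness argument with a definable supremum. If \<open>q\<close> were
  outside \<open>X\<close>, consider the supremum \<open>s\<close> of the points of \<open>X\<close>
  between \<open>p\<close> and \<open>q\<close>. It is no frontier point; in the interior of
  \<open>X\<close> it could be exceeded, and in the interior of the complement it would have no
  points of \<open>X\<close> just below it.\<close>

lemma definably_connected_interval:
  fixes M :: "('a::{linordered_field, linorder_topology}, 'f, 'r) struct"
  assumes "definably_complete M" "definable1 M X" "{p..q} \<inter> frontier X = {}" "p \<le> q" "p \<in> X"
  shows "q \<in> X"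
proof (rule ccontr)
  assume q: "q \<notin> X"
  define Z where "Z = X \<inter> {p..q}"
  have "definable1 M Z"
    unfolding Z_def using assms(2) by (intro definable_Int definable_atLeastAtMost)
  moreover have "p \<in> Z" using assms(4,5) by (simp add: Z_def)
  moreover have "x \<le> q" if "x \<in> Z" for x using that by (simp add: Z_def)
  ultimately obtain s where s: "\<And>x. x \<in> Z \<Longrightarrow> x \<le> s" "\<And>e. e > 0 \<Longrightarrow> \<exists>x\<in>Z. s - e < x"
    using definable_sup[OF assms(1), of Z q] by blast
  have "p \<le> s" using s(1) \<open>p \<in> Z\<close> by blast
  moreover have "s \<le> q"
  proof (rule ccontr)
    assume "\<not> s \<le> q"
    then obtain x where "x \<in> Z" "q < x" using s(2)[of "s - q"] by auto
    then show False by (simp add: Z_def)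
  qed
  ultimately have "s \<in> interior X \<or> s \<in> interior (- X)"
    using assms(3) unfolding frontier_interiors by auto
  then show False
  proof
    assume sX: "s \<in> interior X"
    then obtain e where e: "e > 0" "\<And>y. \<bar>y - s\<bar> < e \<Longrightarrow> y \<in> X"
      unfolding mem_interior_abs by auto
    have "s < q" using \<open>s \<le> q\<close> q sX interior_subset[of X] by (cases "s = q") auto
    then obtain y where y: "s < y" "y < min q (s + e)" using dense e(1)
      by (metis less_add_same_cancel1 min_less_iff_conj)
    have "y \<in> X" using y by (intro e(2)) (simp add: abs_less_iff algebra_simps)
    then have "y \<in> Z" using y \<open>p \<le> s\<close> by (simp add: Z_def)
    then show False using s(1) y(1) by force
  next
    assume "s \<in> interior (- X)"
    then obtain e where e: "e > 0" "\<And>y. \<bar>y - s\<bar> < e \<Longrightarrow> y \<notin> X"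
      unfolding mem_interior_abs by auto
    obtain x where x: "x \<in> Z" "s - e < x" using s(2) e(1) by blast
    have "x \<notin> X" using x s(1)[OF x(1)] e(1) by (intro e(2)) (simp add: abs_less_iff algebra_simps)
    then show False using x(1) by (simp add: Z_def)
  qed
qed

text \<open>Membership propagates to the right both for \<open>X\<close> and for \<open>- X\<close>,
  which share their frontier, so it is constant on the interval.\<close>

lemma definable_subset_or_disjoint:
  fixes M :: "('a::{linordered_field, linorder_topology}, 'f, 'r) struct"
  assumes "definably_complete M" "definable1 M X" "{l<..<r} \<inter> frontier X = {}"
  shows "{l<..<r} \<subseteq> X \<or> {l<..<r} \<inter> X = {}"
proof -
  have "p \<in> X \<longleftrightarrow> q \<in> X" if "p \<in> {l<..<r}" "q \<in> {l<..<r}" "p \<le> q" for p q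
  proof -
    have "{p..q} \<subseteq> {l<..<r}" using that by auto
    then have *: "{p..q} \<inter> frontier X = {}" "{p..q} \<inter> frontier (- X) = {}"
      using assms(3) by auto
    show ?thesis
      using definably_connected_interval[OF assms(1,2) *(1) that(3)]
        definably_connected_interval[OF assms(1) definable_Compl[OF assms(2)] *(2) that(3)]
      by auto
  qed
  then have "p \<in> X \<longleftrightarrow> q \<in> X" if "p \<in> {l<..<r}" "q \<in> {l<..<r}" for p q
    using that linear[of p q] by metis
  then show ?thesis by blast
qed

section \<open>From failure of local o-minimality to a (0+)-set\<close>

lemma open_interval_greaterThanLessThan:
  assumes "l < r"
  shows "open_interval {l<..<r}"
  unfolding open_interval_def
  using assms by (intro exI[of _ "Fin l"] exI[of _ "Fin r"]) auto

text \<open>If \<open>a\<close> had a neighbourhood without further frontier points,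
  \<open>X\<close> would contain or miss each of the two intervals beside \<open>a\<close> entirely.
  Near \<open>a\<close> it would be a union of some of these intervals and possibly the point
  \<open>a\<close>, which is what fails at \<open>a\<close>.\<close>

lemma not_locally_o_minimal_frontier_limit_point:
  fixes M :: "('a::{linordered_field, linorder_topology}, 'f, 'r) struct"
  assumes "definably_complete M" "\<not> locally_o_minimal M"
  obtains X a where "definable1 M X" "a islimpt frontier X"
proof -
  obtain X a where X: "definable1 M X" and not_tame: "\<not> (\<exists>I. open_interval I \<and> a \<in> I \<and>
      (\<exists>\<C>. finite \<C> \<and> (\<forall>C\<in>\<C>. is_singleton C \<or> open_interval C) \<and> X \<inter> I = \<Union>\<C>))"
    using assms(2) unfolding locally_o_minimal_def not_all not_imp by (elim exE conjE)
  have "a islimpt frontier X"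
  proof (rule ccontr)
    assume "\<not> a islimpt frontier X"
    then obtain e where e: "e > 0" "\<And>y. y \<in> frontier X \<Longrightarrow> \<bar>y - a\<bar> < e \<Longrightarrow> y = a"
      unfolding islimpt_abs by blast
    define L where "L = {a - e<..<a}"
    define R where "R = {a<..<a + e}"
    define \<C> where "\<C> = {C \<in> {{a}, L, R}. C \<subseteq> X}"
    have "y \<notin> frontier X" if "y \<in> L \<union> R" for y
      using e(2)[of y] that unfolding L_def R_def by (auto simp: abs_less_iff)
    then have "L \<inter> frontier X = {}" "R \<inter> frontier X = {}" by auto
    then have "L \<subseteq> X \<or> L \<inter> X = {}" "R \<subseteq> X \<or> R \<inter> X = {}"
      unfolding L_def R_def using definable_subset_or_disjoint[OF assms(1) X] by auto
    moreover have "{a - e<..<a + e} = {a} \<union> L \<union> R"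
      unfolding L_def R_def using e(1) by auto
    ultimately have "X \<inter> {a - e<..<a + e} = \<Union>\<C>" unfolding \<C>_def by auto
    moreover have "finite \<C>" unfolding \<C>_def by simp
    moreover have "open_interval L" "open_interval R"
      unfolding L_def R_def using e(1) by (auto intro: open_interval_greaterThanLessThan)
    then have "\<forall>C\<in>\<C>. is_singleton C \<or> open_interval C"
      unfolding \<C>_def by (auto simp: is_singleton_def)
    moreover have "open_interval {a - e<..<a + e}" "a \<in> {a - e<..<a + e}"
      using e(1) open_interval_greaterThanLessThan[of "a - e" "a + e"] by auto
    ultimately show False
      using not_tame by (elim notE, intro exI[of _ "{a - e<..<a + e}"] exI[of _ \<C>] conjI)
  qed
  with X show thesis by (rule that)
qed

text \<open>The sign \<open>\<sigma>\<close> records a side from which \<open>S\<close> accumulates.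
  Gaps on both sides would leave no point of \<open>S\<close> other than \<open>a\<close> within the
  smaller gap.\<close>

lemma islimpt_one_sided:
  fixes a :: "'a::{linordered_field, linorder_topology}"
  assumes "a islimpt S"
  obtains \<sigma> where "\<sigma> = 1 \<or> \<sigma> = - 1" "0 islimpt {t. 0 < t \<and> a + \<sigma> * t \<in> S}"
proof -
  let ?D = "\<lambda>\<sigma>. {t. 0 < t \<and> a + \<sigma> * t \<in> S}"
  have "0 islimpt ?D 1 \<or> 0 islimpt ?D (- 1)"
  proof (rule ccontr)
    assume "\<not> ?thesis"
    moreover have "?D \<sigma> \<subseteq> {0<..}" for \<sigma> by auto
    ultimately obtain d e where de: "d > 0" "e > 0" "\<And>t. t \<in> ?D 1 \<Longrightarrow> \<not> t < d"
      "\<And>t. t \<in> ?D (- 1) \<Longrightarrow> \<not> t < e"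
      unfolding zero_islimpt_iff[OF \<open>?D _ \<subseteq> {0<..}\<close>] by auto
    then have "min d e > 0" by simp
    then obtain y where y: "y \<in> S" "y \<noteq> a" "\<bar>y - a\<bar> < min d e"
      using assms unfolding islimpt_abs by blast
    show False
      using de(3)[of "y - a"] de(4)[of "a - y"] y by (cases "a < y") auto
  qed
  then show thesis using that by blast
qed

lemma zero_plus_sets_nonempty:
  fixes M :: "('a::{linordered_field, linorder_topology}, 'f, 'r) struct"
  assumes "expands_ordered_field M" "d_minimal M" "\<not> locally_o_minimal M"
  shows "zero_plus_sets M \<noteq> {}"
proof -
  have complete: "definably_complete M" using assms(2) by (simp add: d_minimal_def)
  obtain X a where X: "definable1 M X" "a islimpt frontier X"
    using not_locally_o_minimal_frontier_limit_point[OF complete assms(3)] .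
  obtain \<S> where "finite \<S>" "\<forall>S\<in>\<S>. discrete S" "frontier X \<subseteq> \<Union>\<S>"
    using frontier_finite_discrete[OF assms(1,2) X(1)] by (elim exE conjE)
  then obtain u v b where b: "{x. x islimpt frontier X \<inter> {u..v}} = {b}"
    using isolated_limit_point[of \<S> "frontier X" a] X(2) frontier_closed[of X] by blast
  define C where "C = frontier X \<inter> {u..v}"
  have C: "definable1 M C"
    unfolding C_def using assms(1) X(1)
    by (intro definable_Int definable_frontier definable_atLeastAtMost)
  have "b islimpt C" using b unfolding C_def by blast
  then obtain \<sigma> where \<sigma>: "\<sigma> = 1 \<or> \<sigma> = - 1" and lim: "0 islimpt {t. 0 < t \<and> b + \<sigma> * t \<in> C}"
    by (rule islimpt_one_sided)
  define D where "D = {t. 0 < t \<and> b + \<sigma> * t \<in> C}"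
  have "D \<in> zero_plus_sets M"
  proof (rule zero_plus_setsI)
    \<comment> \<open>The auxiliary \<open>z\<close> stands for \<open>b + t\<close> or
      \<open>b - t\<close>; stating it by an equation between sums avoids multiplication and
      subtraction.\<close>
    have "D = (if \<sigma> = 1 then {t. 0 < t \<and> (\<exists>z. z = b + t \<and> z \<in> C)}
      else {t. 0 < t \<and> (\<exists>z. z + t = b \<and> z \<in> C)})"
      using \<sigma> unfolding D_def by (auto simp: eq_diff_eq[symmetric])
    moreover have "definable1 M {t. 0 < t \<and> (\<exists>z. z = b + t \<and> z \<in> C)}"
      using assms(1) C by (intro definable1I definable_pred_intros) simp_all
    moreover have "definable1 M {t. 0 < t \<and> (\<exists>z. z + t = b \<and> z \<in> C)}"
      using assms(1) C by (intro definable1I definable_pred_intros) simp_all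
    ultimately show "definable1 M D" by simp
    show "D \<subseteq> {0<..}" unfolding D_def by auto
    show "t \<le> max (v - b) (b - u)" if "t \<in> D" for t
      using that \<sigma> unfolding D_def C_def by (auto simp: le_max_iff_disj algebra_simps)
    \<comment> \<open>The map \<open>t\<close> to \<open>b + \<sigma> * t\<close> preserves
      distances, so limit points of \<open>D\<close> go to limit points of \<open>C\<close>, of
      which \<open>b\<close> is the only one.\<close>
    have "b + \<sigma> * x islimpt C" if "x islimpt D" for x
      unfolding islimpt_abs
    proof (intro allI impI)
      fix e :: 'a assume "e > 0"
      then obtain y where y: "y \<in> D" "y \<noteq> x" "\<bar>y - x\<bar> < e"
        using \<open>x islimpt D\<close> unfolding islimpt_abs by blast
      have "(b + \<sigma> * y) - (b + \<sigma> * x) = \<sigma> * (y - x)" by (simp add: algebra_simps)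
      then have "\<bar>(b + \<sigma> * y) - (b + \<sigma> * x)\<bar> = \<bar>y - x\<bar>" using \<sigma> by (auto simp: abs_minus_commute)
      moreover have "b + \<sigma> * y \<in> C" using y(1) by (simp add: D_def)
      ultimately show "\<exists>z\<in>C. z \<noteq> b + \<sigma> * x \<and> \<bar>z - (b + \<sigma> * x)\<bar> < e"
        using y(2,3) by (intro bexI[of _ "b + \<sigma> * y"]) auto
    qed
    then have "x = 0" if "x islimpt D" for x
      using b that \<sigma> unfolding C_def by force
    then show "{x. x islimpt D} = {0}" using lim unfolding D_def by blast
  qed
  then show ?thesis by blast
qed

subsection \<open>Limit sets\<close>

lemma mem_graph_iff:
  "(\<lambda>j\<in>{..<1 + n}. if j = 0 then t else y (j - 1)) \<in>
     (\<lambda>t. append_tuples 1 n (singleton_tuple t) (f t)) ` D \<longleftrightarrow> t \<in> D \<and> (\<forall>i<n. y i = f t i)"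
proof -
  have append: "append_tuples 1 n (singleton_tuple s) z = (\<lambda>j\<in>{..<1 + n}. if j = 0 then s else z (j - 1))"
    for s and z :: "nat \<Rightarrow> 'a"
    by (auto simp: append_tuples_def singleton_tuple_def fun_eq_iff)
  have eq: "(\<lambda>j\<in>{..<1 + n}. if j = 0 then t else y (j - 1)) =
      (\<lambda>j\<in>{..<1 + n}. if j = 0 then s else z (j - 1)) \<longleftrightarrow> t = s \<and> (\<forall>i<n. y i = z i)"
    (is "?f = ?g \<longleftrightarrow> _") for s z
  proof
    assume eq: "?f = ?g"
    have "t = s" using fun_cong[OF eq, of 0] by simp
    moreover have "y i = z i" if "i < n" for i using fun_cong[OF eq, of "Suc i"] that by simp
    ultimately show "t = s \<and> (\<forall>i<n. y i = z i)" by simp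
  qed (auto simp: fun_eq_iff)
  show ?thesis unfolding image_iff append eq by blast
qed

text \<open>The value of \<open>f\<close> is not a term, so it is reached through the graph: some
  \<open>y\<close> forms a graph point with the argument and is close to \<open>p\<close>. The
  coordinates of \<open>p\<close> are parameters.\<close>

lemma definable_pred_map_near:
  fixes M :: "('a::linordered_field, 'f, 'r) struct"
  assumes "expands_ordered_field M" "definable_map M D n f"
  shows "definable_pred M 2 (\<lambda>x. x 0 \<in> D \<and> (\<forall>i<n. \<bar>f (x 0) i - p i\<bar> < x 1))"
proof -
  let ?graph = "(\<lambda>t. append_tuples 1 n (singleton_tuple t) (f t)) ` D"
  \<comment> \<open>Place 0 holds the argument, place 1 the radius, and the places from 2 on hold
    the value; \<open>?r\<close> skips the radius to obtain the graph tuple.\<close>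
  let ?r = "\<lambda>j. if j = (0::nat) then 0 else Suc j"
  let ?P = "\<lambda>x. (\<lambda>j\<in>{..<1 + n}. x (?r j)) \<in> ?graph \<and>
    (\<forall>i<n. x (2 + i) < p i + x 1 \<and> p i < x (2 + i) + x 1)"
  have "definable_pred M (2 + n) (\<lambda>x. (\<lambda>j\<in>{..<1 + n}. x (?r j)) \<in> ?graph)"
    using assms(2) by (intro definable_pred_mem_tuples) (auto simp: definable_map_def inj_on_def)
  then have "definable_pred M (2 + n) ?P"
    by (intro definable_pred_conj definable_pred_all_less definable_pred_less definable_term_add
        definable_term_var definable_term_const assms(1)) simp_all
  from definable_pred_ex_block[OF this]
  have "definable_pred M 2 (\<lambda>x. \<exists>y. ?P (\<lambda>i. if i < 2 then x i else y (i - 2)))" .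
  moreover have "(\<exists>y. ?P (\<lambda>i. if i < 2 then x i else y (i - 2))) \<longleftrightarrow>
    x 0 \<in> D \<and> (\<forall>i<n. \<bar>f (x 0) i - p i\<bar> < x 1)" for x
  proof -
    have eq: "(\<lambda>j\<in>{..<1 + n}. if ?r j < 2 then x (?r j) else y (?r j - 2)) =
      (\<lambda>j\<in>{..<1 + n}. if j = 0 then x 0 else y (j - 1))" for y
      by (auto simp: fun_eq_iff)
    have abs: "a < b + c \<and> b < a + c \<longleftrightarrow> \<bar>a - b\<bar> < c" for a b c :: 'a
      by (auto simp: abs_less_iff algebra_simps)
    have "?P (\<lambda>i. if i < 2 then x i else y (i - 2)) \<longleftrightarrow>
      x 0 \<in> D \<and> (\<forall>i<n. y i = f (x 0) i) \<and> (\<forall>i<n. \<bar>y i - p i\<bar> < x 1)" for y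
    proof -
      have "?P (\<lambda>i. if i < 2 then x i else y (i - 2)) \<longleftrightarrow>
        (\<lambda>j\<in>{..<1 + n}. if ?r j < 2 then x (?r j) else y (?r j - 2)) \<in> ?graph \<and>
        (\<forall>i<n. y i < p i + x 1 \<and> p i < y i + x 1)"
        by simp
      also have "\<dots> \<longleftrightarrow> (x 0 \<in> D \<and> (\<forall>i<n. y i = f (x 0) i)) \<and> (\<forall>i<n. \<bar>y i - p i\<bar> < x 1)"
        unfolding eq mem_graph_iff[where t = "x 0" and y = y and f = f and D = D] abs ..
      finally show ?thesis by (simp only: conj_assoc)
    qed
    then show ?thesis by auto
  qed
  ultimately show ?thesis by simp
qed

section \<open>Limit sets described by radii\<close>

lemma open_interval_around:
  fixes x :: "'a::{linordered_field, linorder_topology}"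
  assumes "open_interval I" "x \<in> I"
  shows "\<exists>e>0. \<forall>y. \<bar>y - x\<bar> < e \<longrightarrow> y \<in> I"
proof -
  obtain a b :: "'a extended" where I: "I = {x. a < Fin x \<and> Fin x < b}"
    using assms(1) unfolding open_interval_def by blast
  have "open {x. a < Fin x}" by (cases a) (auto simp: greaterThan_def[symmetric])
  moreover have "open {x. Fin x < b}" by (cases b) (auto simp: lessThan_def[symmetric])
  ultimately have "open I" unfolding I Collect_conj_eq by (rule open_Int)
  then show ?thesis using assms(2) by (rule open_contains_abs_less)
qed

lemma open_interval_abs_less:
  fixes x :: "'a::linordered_field"
  assumes "e > 0"
  shows "open_interval {y. \<bar>y - x\<bar> < e}"
  unfolding open_interval_def
  using assms by (intro exI[of _ "Fin (x - e)"] exI[of _ "Fin (x + e)"]) (auto simp: abs_less_iff)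

lemma limit_set_iff:
  fixes D :: "'a::{linordered_field, linorder_topology} set"
  assumes "D \<subseteq> {0<..}" "f ` D \<subseteq> tuples n" "p \<in> tuples n"
  shows "p \<in> limit_set D n f \<longleftrightarrow> (\<forall>e>0. \<exists>t\<in>D. t < e \<and> (\<forall>i<n. \<bar>f t i - p i\<bar> < e))"
proof (intro iffI allI impI)
  fix e :: 'a assume p: "p \<in> limit_set D n f" and e: "e > 0"
  let ?B = "\<Pi>\<^sub>E i\<in>{..<n}. {y. \<bar>y - p i\<bar> < e}"
  have box: "open_box n ?B"
    unfolding open_box_def using open_interval_abs_less[OF e]
    by (intro exI[of _ "\<lambda>i. {y. \<bar>y - p i\<bar> < e}"]) simp
  have mem: "p \<in> ?B" "0 \<in> {y. \<bar>y - 0\<bar> < e}" using assms(3) e by (auto simp: tuples_def PiE_iff)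
  have "{t \<in> D. f t \<in> B} \<inter> I \<noteq> {}"
    if "open_box n B" "p \<in> B" "open_interval I" "0 \<in> I" for B I
    using p that by (simp add: limit_set_def)
  from this[OF box mem(1) open_interval_abs_less[OF e] mem(2)]
  have "{t \<in> D. f t \<in> ?B} \<inter> {y. \<bar>y - 0\<bar> < e} \<noteq> {}" .
  then obtain t where "t \<in> D" "f t \<in> ?B" "\<bar>t\<bar> < e" by auto
  then show "\<exists>t\<in>D. t < e \<and> (\<forall>i<n. \<bar>f t i - p i\<bar> < e)"
    by (intro bexI[of _ t]) (auto simp: PiE_iff)
next
  assume near: "\<forall>e>0. \<exists>t\<in>D. t < e \<and> (\<forall>i<n. \<bar>f t i - p i\<bar> < e)"
  have "{t \<in> D. f t \<in> B} \<inter> I \<noteq> {}"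
    if B: "open_box n B" "p \<in> B" and I: "open_interval I" "0 \<in> I" for B I
  proof -
    obtain J where J: "\<And>i. i < n \<Longrightarrow> open_interval (J i)" "B = (\<Pi>\<^sub>E i\<in>{..<n}. J i)"
      using B(1) unfolding open_box_def by auto
    have "\<exists>e>0. \<forall>y. \<bar>y - p i\<bar> < e \<longrightarrow> y \<in> J i" if "i < n" for i
      using open_interval_around[OF J(1)[OF that], of "p i"] B(2) that by (auto simp: J(2))
    then obtain d where d: "\<And>i. i < n \<Longrightarrow> d i > 0"
      "\<And>i y. i < n \<Longrightarrow> \<bar>y - p i\<bar> < d i \<Longrightarrow> y \<in> J i"
      by (metis (no_types))
    obtain c where c: "c > 0" "\<And>y. \<bar>y - 0\<bar> < c \<Longrightarrow> y \<in> I"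
      using open_interval_around[OF I] by auto
    \<comment> \<open>A box has finitely many sides, so one radius serves all of them. Including
      \<open>c\<close> takes care of the interval around \<open>0\<close> and keeps the minimum
      defined for \<open>n = 0\<close>.\<close>
    define e where "e = Min (insert c (d ` {..<n}))"
    have "e > 0" unfolding e_def using c(1) d(1) by auto
    then obtain t where t: "t \<in> D" "t < e" "\<forall>i<n. \<bar>f t i - p i\<bar> < e" using near by blast
    have "e \<le> c" "\<And>i. i < n \<Longrightarrow> e \<le> d i" unfolding e_def by (auto intro: Min_le)
    then have "f t i \<in> J i" if "i < n" for i
      using that t(3) d(2)[OF that] by (meson less_le_trans)
    moreover have "f t \<in> tuples n" using assms(2) t(1) by auto
    ultimately have "f t \<in> B" unfolding J(2) by (auto simp: tuples_def PiE_iff)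
    moreover have "t \<in> I"
      using t(1,2) assms(1) \<open>e \<le> c\<close> by (intro c(2)) auto
    ultimately show ?thesis using t(1) by blast
  qed
  then show "p \<in> limit_set D n f" using assms(3) unfolding limit_set_def by simp
qed

text \<open>For \<open>s > 0\<close> let \<open>t s\<close> be the largest \<open>t \<in> D\<close> with \<open>t \<le> s\<close> at which \<open>f\<close> is \<open>s\<close>-close to
  \<open>p\<close>.  Since \<open>t s\<close> is monotone in \<open>s\<close>, small values of \<open>t s\<close> come from small \<open>s\<close>, so \<open>f\<close> tends
  to \<open>p\<close> along the set \<open>D'\<close> of all these points.\<close>

lemma limit_set_singleton:
  fixes M :: "('a::{linordered_field, linorder_topology}, 'f, 'r) struct"
  assumes "expands_ordered_field M" "definably_complete M" "D \<in> zero_plus_sets M"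
    "definable_map M D n f" "p \<in> limit_set D n f"
  shows "\<exists>D'\<in>zero_plus_sets M. D' \<subseteq> D \<and> limit_set D' n f = {p}"
proof -
  have pos: "D \<subseteq> {0<..}" and range: "f ` D \<subseteq> tuples n" and p: "p \<in> tuples n"
    using assms(3-5) by (auto simp: zero_plus_sets_def definable_map_def limit_set_def)
  define G where "G t s \<longleftrightarrow> t \<in> D \<and> (\<forall>i<n. \<bar>f t i - p i\<bar> < s)" for t s
  have G_mono: "G t s'" if "G t s" "s \<le> s'" for t s s'
    using that unfolding G_def by (meson less_le_trans)
  have G_near: "\<exists>t. t < e \<and> G t e" if "e > 0" for e
    using assms(5) that unfolding limit_set_iff[OF pos range p] G_def by blast
  have G_pred: "definable_pred M n (\<lambda>x. G (x i) (x j))" if "i < n" "j < n" "i \<noteq> j" for n i j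
    using definable_pred_map_near[OF assms(1,4), of p] that
    unfolding G_def by (rule definable_pred_binary)
  define D' where "D' = {t. \<exists>s. 0 < s \<and> t \<le> s \<and> G t s \<and> (\<forall>t'. t < t' \<and> t' \<le> s \<longrightarrow> \<not> G t' s)}"
  have D'_sub: "D' \<subseteq> D" unfolding D'_def G_def by auto
  have "definable1 M D'"
    unfolding D'_def by (intro definable1I definable_pred_intros G_pred) simp_all
  moreover have D'_limit: "0 islimpt D'"
    unfolding zero_islimpt_iff[OF subset_trans[OF D'_sub pos]]
  proof (intro allI impI)
    fix e :: 'a assume "e > 0"
    \<comment> \<open>The largest admissible point below or at \<open>s\<close> is then strictly
      below \<open>e\<close>.\<close>
    define s where "s = e / 2"
    have s: "0 < s" "s < e" using \<open>e > 0\<close> by (auto simp: s_def)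
    define Z where "Z = {t. t \<le> s \<and> G t s}"
    obtain t0 where t0: "t0 < s" "G t0 s" using G_near[OF s(1)] by blast
    have "definable1 M Z"
    proof -
      \<comment> \<open>The constant \<open>s\<close> is passed through a bound \<open>z\<close>,
        because \<open>G_pred\<close> speaks of coordinates only.\<close>
      have "Z = {t. \<exists>z. z = s \<and> t \<le> z \<and> G t z}" by (simp add: Z_def)
      also have "definable1 M \<dots>" by (intro definable1I definable_pred_intros G_pred) simp_all
      finally show ?thesis .
    qed
    moreover have "t0 \<in> Z" using t0 by (simp add: Z_def)
    moreover have "x \<le> s" if "x \<in> Z" for x using that by (simp add: Z_def)
    ultimately obtain m where m: "\<And>x. x \<in> Z \<Longrightarrow> x \<le> m" "\<And>e. e > 0 \<Longrightarrow> \<exists>x\<in>Z. m - e < x"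
      using definable_sup[OF assms(2), of Z s] by blast
    \<comment> \<open>The supremum is attained: otherwise it would be a limit point of
      \<open>D\<close>, thus \<open>0\<close>, although the positive \<open>t0\<close> lies in
      \<open>Z\<close>.\<close>
    have "m \<in> Z"
    proof (rule ccontr)
      assume "m \<notin> Z"
      have "m islimpt D"
        unfolding islimpt_abs
      proof (intro allI impI)
        fix d :: 'a assume "d > 0"
        then obtain x where x: "x \<in> Z" "m - d < x" using m(2) by blast
        then have "x \<noteq> m" "x \<in> D" "x \<le> m" using \<open>m \<notin> Z\<close> m(1) by (auto simp: Z_def G_def)
        then show "\<exists>y\<in>D. y \<noteq> m \<and> \<bar>y - m\<bar> < d"
          using x(2) by (intro bexI[of _ x]) auto
      qed
      then have "m \<in> {x. x islimpt D}" by simp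
      then have "m = 0" unfolding zero_plus_sets_limit_points[OF assms(3)] by simp
      moreover have "0 < t0" using t0(2) pos by (auto simp: G_def)
      ultimately show False using m(1)[OF \<open>t0 \<in> Z\<close>] by simp
    qed
    have "m \<in> D'"
      unfolding D'_def mem_Collect_eq
    proof (intro exI[of _ s] conjI allI impI)
      fix t' assume "m < t' \<and> t' \<le> s"
      then show "\<not> G t' s" using m(1)[of t'] by (auto simp: Z_def)
    qed (use \<open>m \<in> Z\<close> s in \<open>auto simp: Z_def\<close>)
    moreover have "m < e" using \<open>m \<in> Z\<close> s by (auto simp: Z_def)
    ultimately show "\<exists>t\<in>D'. t < e" by blast
  qed
  ultimately have "D' \<in> zero_plus_sets M"
    using zero_plus_sets_subset[OF assms(3) D'_sub] by blast
  moreover have D'_near: "\<exists>d>0. \<forall>t\<in>D'. t < d \<longrightarrow> G t e" if "e > 0" for e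
  proof -
    obtain t0 where t0: "t0 < e" "G t0 e" using G_near[OF \<open>e > 0\<close>] by blast
    have "G t e" if t: "t \<in> D'" "t < t0" for t
    proof -
      obtain s where s: "G t s" "\<And>t'. t < t' \<Longrightarrow> t' \<le> s \<Longrightarrow> \<not> G t' s"
        using t(1) unfolding D'_def by auto
      \<comment> \<open>If \<open>s\<close> exceeded \<open>e\<close>, then \<open>t0\<close> would
        be admissible for \<open>s\<close> and larger than \<open>t\<close>, against the maximality
        of \<open>t\<close>.\<close>
      have "s \<le> e"
      proof (rule ccontr)
        assume "\<not> s \<le> e"
        then show False using s(2)[OF t(2)] t0 G_mono[OF t0(2), of s] by simp
      qed
      then show ?thesis using G_mono[OF s(1)] by blast
    qed
    moreover have "t0 > 0" using t0(2) pos by (auto simp: G_def)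
    ultimately show ?thesis by blast
  qed
  moreover have "limit_set D' n f = {p}"
  proof (intro equalityI subsetI)
    have pos': "D' \<subseteq> {0<..}" and range': "f ` D' \<subseteq> tuples n"
      using D'_sub pos range by auto
    fix q
    show "q \<in> limit_set D' n f" if "q \<in> {p}"
    proof -
      have "\<exists>t\<in>D'. t < e \<and> (\<forall>i<n. \<bar>f t i - p i\<bar> < e)" if e: "e > 0" for e
      proof -
        obtain d where d: "d > 0" "\<And>t. t \<in> D' \<Longrightarrow> t < d \<Longrightarrow> G t e" using D'_near[OF e] by blast
        have "min d e > 0" using d(1) e by simp
        then obtain t where "t \<in> D'" "t < min d e"
          using D'_limit unfolding zero_islimpt_iff[OF pos'] by blast
        then show ?thesis using d(2)[of t] by (intro bexI[of _ t]) (auto simp: G_def)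
      qed
      then show ?thesis using that limit_set_iff[OF pos' range' p] by simp
    qed
    show "q \<in> {p}" if q: "q \<in> limit_set D' n f"
    proof (rule ccontr)
      assume "q \<notin> {p}"
      have q': "q \<in> tuples n" using q by (simp add: limit_set_def)
      then obtain i where i: "i < n" "q i \<noteq> p i"
        using p \<open>q \<notin> {p}\<close> unfolding tuples_def by (metis PiE_ext lessThan_iff singletonI)
      \<comment> \<open>At half the distance, a value cannot be close to both \<open>p\<close> and
        \<open>q\<close> in coordinate \<open>i\<close>.\<close>
      define e where "e = \<bar>q i - p i\<bar> / 2"
      have "e > 0" using i(2) by (simp add: e_def)
      then obtain d where d: "d > 0" "\<And>t. t \<in> D' \<Longrightarrow> t < d \<Longrightarrow> G t e" using D'_near by blast
      have "min d e > 0" using d(1) \<open>e > 0\<close> by simp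
      then obtain t where t: "t \<in> D'" "t < min d e" "\<forall>i<n. \<bar>f t i - q i\<bar> < min d e"
        using q unfolding limit_set_iff[OF pos' range' q'] by blast
      have "\<bar>f t i - p i\<bar> < e" using d(2)[OF t(1)] t(2) i(1) by (simp add: G_def)
      moreover have "\<bar>f t i - q i\<bar> < e" using t(3) i(1) by simp
      moreover have "\<bar>q i - p i\<bar> \<le> \<bar>f t i - q i\<bar> + \<bar>f t i - p i\<bar>" by (simp add: abs_if)
      ultimately have "\<bar>q i - p i\<bar> < e + e" by linarith
      then show False by (simp add: e_def)
    qed
  qed
  ultimately show ?thesis using D'_sub by blast
qed

theorem proposition7p21:
  fixes M :: "('a::{linordered_field, linorder_topology}, 'f, 'r) struct"
  assumes "expands_ordered_field M"
    and "d_minimal M"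
    and "\<not> locally_o_minimal M"
  shows "zero_plus_sets M \<noteq> {} \<and>
    (\<forall>D\<in>zero_plus_sets M. order_bounded D \<and> closure D = D \<union> {0}) \<and>
    (\<forall>D\<in>zero_plus_sets M. \<forall>D1 D2. definable1 M D1 \<and> definable1 M D2 \<and> D = D1 \<union> D2 \<longrightarrow>
       (\<exists>D'\<in>zero_plus_sets M. D' \<subseteq> D1) \<or> (\<exists>D'\<in>zero_plus_sets M. D' \<subseteq> D2)) \<and>
    (\<forall>D\<in>zero_plus_sets M. \<forall>n \<gamma>. definable_map M D n \<gamma> \<longrightarrow>
       (\<exists>D'\<in>zero_plus_sets M. D' \<subseteq> D \<and>
          continuous_map (top_of_set D') (tuples_topology n) \<gamma>) \<and>
       (limit_set D n \<gamma> \<noteq> {} \<longrightarrow>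
          (\<exists>D'\<in>zero_plus_sets M. D' \<subseteq> D \<and>
             continuous_map (top_of_set D') (tuples_topology n) \<gamma> \<and>
             is_singleton (limit_set D' n \<gamma>))))"
proof (intro conjI ballI allI impI)
  note complete = assms(2)[unfolded d_minimal_def, THEN conjunct1]
  show "zero_plus_sets M \<noteq> {}" using zero_plus_sets_nonempty[OF assms] .
  fix D assume D: "D \<in> zero_plus_sets M"
  show "order_bounded D" "closure D = D \<union> {0}" using D by (simp_all add: zero_plus_sets_def)
  show "(\<exists>D'\<in>zero_plus_sets M. D' \<subseteq> D1) \<or> (\<exists>D'\<in>zero_plus_sets M. D' \<subseteq> D2)"
    if split: "definable1 M D1 \<and> definable1 M D2 \<and> D = D1 \<union> D2" for D1 D2
  proof -
    have sub: "D1 \<subseteq> D" "D2 \<subseteq> D" using split by simp_all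
    have "0 \<in> {x. x islimpt D}" unfolding zero_plus_sets_limit_points[OF D] by simp
    then have "0 islimpt D1 \<or> 0 islimpt D2" using split by (simp add: islimpt_Un)
    then show ?thesis
    proof
      assume "0 islimpt D1"
      then have "D1 \<in> zero_plus_sets M" using zero_plus_sets_subset[OF D sub(1)] split by simp
      then show ?thesis by blast
    next
      assume "0 islimpt D2"
      then have "D2 \<in> zero_plus_sets M" using zero_plus_sets_subset[OF D sub(2)] split by simp
      then show ?thesis by blast
    qed
  qed
  fix n \<gamma> assume \<gamma>: "definable_map M D n \<gamma>"
  have cont: "continuous_map (top_of_set D') (tuples_topology n) \<gamma>"
    if "D' \<in> zero_plus_sets M" "D' \<subseteq> D" for D'
  proof (rule continuous_map_discrete)
    show "discrete D'" using that(1) by (simp add: zero_plus_sets_def)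
    show "\<gamma> ` D' \<subseteq> topspace (tuples_topology n)"
      using \<gamma> that(2) by (auto simp: definable_map_def tuples_topology_def tuples_def)
  qed
  \<comment> \<open>Without a condition on the limit set, \<open>D\<close> itself serves as
    \<open>D'\<close>.\<close>
  show "\<exists>D'\<in>zero_plus_sets M. D' \<subseteq> D \<and> continuous_map (top_of_set D') (tuples_topology n) \<gamma>"
    using D cont by blast
  assume "limit_set D n \<gamma> \<noteq> {}"
  then obtain p where "p \<in> limit_set D n \<gamma>" by blast
  then obtain D' where D': "D' \<in> zero_plus_sets M" "D' \<subseteq> D" "limit_set D' n \<gamma> = {p}"
    using limit_set_singleton[OF assms(1) complete D \<gamma>] by blast
  show "\<exists>D'\<in>zero_plus_sets M. D' \<subseteq> D \<and>
      continuous_map (top_of_set D') (tuples_topology n) \<gamma> \<and> is_singleton (limit_set D' n \<gamma>)"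
    using D'(1,2) cont[OF D'(1,2)] by (intro bexI[of _ D']) (simp_all add: D'(3))
qed

end
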